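(* Let $P$ be a Poisson algebra, $E$ a vector space and $\pi : E \to P$ an epimorphism of vector spaces with $V = \mathrm{Ker}(\pi)$. Then $\approx$ is an equivalence relation on the set $\mathcal{PS}(P,V)$ of all crossed systems of $P$ by $V$. If we denote $\mathcal{GPH}^2(P,V) := \mathcal{PS}(P,V)/\approx$, then the map $$\mathcal{GPH}^2(P,V) \to \mathrm{Gext}(P,E), \qquad \overline{(\rightharpoonup, \triangleleft, \vartheta, \cdot_V, \triangleright, f, [-,-]_V)} \longmapsto P \,\sharp_{(\rightharpoonup, \triangleleft, \vartheta, \cdot_V, \triangleright, f, [-,-]_V)}\, V$$ is a bijection. Here the crossed product $P\,\sharp\,V$, whose underlying space is $P\times V$, is regarded as (the class in $\mathrm{Gext}(P,E)$ of) a Poisson algebra structure on $E$ by transport along the linear isomorphism $P \times V \to E$, $(p,x)\mapsto s(p)+x$, where $s:P\to E$ is a $k$-linear section of $\pi$.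
   Context: $k$ is an arbitrary field; all vector spaces, algebras, linear and bilinear maps are over $k$. Algebras are associative, not necessarily commutative or unital. A Poisson algebra is a vector space $P$ with an associative multiplication $pq$ and a Lie bracket $[-,-]$ such that $[pq,r]=[p,r]q+p[q,r]$ for all $p,q,r\in P$. A morphism of Poisson algebras is a linear map that is a morphism of associative algebras and of Lie algebras. A pre-crossed datum of a Poisson algebra $P$ by a vector space $V$ is a system $\Omega(P,V)=(\rightharpoonup,\triangleleft,\vartheta,\cdot_V,\triangleright,f,[-,-]_V)$ of seven bilinear maps $\rightharpoonup: P\times V\to V$, $\triangleleft: V\times P\to V$, $\vartheta:P\times P\to V$, $\cdot_V:V\times V\to V$, $\triangleright:P\times V\to V$, $f:P\times P\to V$, $[-,-]_V:V\times V\to V$. Write $P\,\sharp\,V = P\,\sharp_{\Omega(P,V)}\,V$ for the vector space $P\times V$ with $(p,x)\star(q,y):=(pq,\ \vartheta(p,q)+p\rightharpoonup y+x\triangleleft q+x\cdot_V y)$ and $\{(p,x),(q,y)\}:=([p,q],\ f(p,q)+p\triangleright y-q\triangleright x+[x,y]_V)$. A crossed system is a pre-crossed datum satisfying, for all $p,q,r\in P$, $x,y\in V$ (equivalently, $P\,\sharp\,V$ is a Poisson algebra, then called the crossed product): (0) $(V,\cdot_V,[-,-]_V)$ is a Poisson algebra; (H1) $(x\cdot_V y)\triangleleft p=x\cdot_V(y\triangleleft p)$; (H2) $(x\triangleleft p)\cdot_V y=x\cdot_V(p\rightharpoonup y)$; (H3) $p\rightharpoonup(x\cdot_V y)=(p\rightharpoonup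 x)\cdot_V y$; (H4) $(p\rightharpoonup x)\triangleleft q=p\rightharpoonup(x\triangleleft q)$; (H5) $\vartheta(p,q)\triangleleft r=\vartheta(p,qr)-\vartheta(pq,r)+p\rightharpoonup\vartheta(q,r)$; (H6) $(pq)\rightharpoonup x=p\rightharpoonup(q\rightharpoonup x)-\vartheta(p,q)\cdot_V x$; (H7) $x\triangleleft(pq)=(x\triangleleft p)\triangleleft q-x\cdot_V\vartheta(p,q)$; (L1) $f(p,p)=0$; (L2) $p\triangleright[x,y]_V=[p\triangleright x,y]_V+[x,p\triangleright y]_V$; (L3) $[p,q]\triangleright x=p\triangleright(q\triangleright x)-q\triangleright(p\triangleright x)+[x,f(p,q)]_V$; (L4) $f(p,[q,r])+f(q,[r,p])+f(r,[p,q])+p\triangleright f(q,r)+q\triangleright f(r,p)+r\triangleright f(p,q)=0$; (P1) $f(pq,r)-f(p,r)\triangleleft q-p\rightharpoonup f(q,r)=r\triangleright\vartheta(p,q)+\vartheta([p,r],q)+\vartheta(p,[q,r])$; (P2) $(pq)\triangleright x=p\rightharpoonup(q\triangleright x)+(p\triangleright x)\triangleleft q-[\vartheta(p,q),x]_V$; (P3) $[p,q]\rightharpoonup x=p\rightharpoonup(q\triangleright x)-q\triangleright(p\rightharpoonup x)-f(p,q)\cdot_V x$; (P4) $p\rightharpoonup[x,y]_V=[p\rightharpoonup x,y]_V-(p\triangleright y)\cdot_V x$; (P5) $x\triangleleft[p,q]=(q\triangleright x)\triangleleft p-q\triangleright(x\triangleleft p)-x\cdot_V f(p,q)$; (P6)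 $[x,y]_V\triangleleft p=[x\triangleleft p,y]_V-x\cdot_V(p\triangleright y)$; (P7) $p\triangleright(x\cdot_V y)=(p\triangleright x)\cdot_V y+x\cdot_V(p\triangleright y)$. $\mathcal{PS}(P,V)$ denotes the set of all crossed systems of $P$ by $V$. Two crossed systems $\Omega(P,V)=(\rightharpoonup,\triangleleft,\vartheta,\cdot_V,\triangleright,f,[-,-]_V)$ and $\Omega'(P,V)=(\rightharpoonup',\triangleleft',\vartheta',\cdot'_V,\triangleright',f',[-,-]'_V)$ are cohomologous, written $\Omega(P,V)\approx\Omega'(P,V)$, if $\cdot_V=\cdot'_V$, $[-,-]_V=[-,-]'_V$ and there is a linear map $r:P\to V$ such that for all $p,q\in P$, $x\in V$: $p\rightharpoonup x=p\rightharpoonup' x+r(p)\cdot_V x$; $x\triangleleft p=x\triangleleft' p+x\cdot_V r(p)$; $\vartheta(p,q)=\vartheta'(p,q)+p\rightharpoonup' r(q)+r(p)\triangleleft' q-r(pq)+r(p)\cdot_V r(q)$; $p\triangleright x=p\triangleright' x+[r(p),x]_V$; $f(p,q)=f'(p,q)+p\triangleright' r(q)-q\triangleright' r(p)+[r(p),r(q)]_V-r([p,q])$. $\mathrm{Gext}(P,E)$ is the set of equivalence classes of Poisson algebra structures $(\cdot_E,[-,-]_E)$ on $E$ for which $\pi:(E,\cdot_E,[-,-]_E)\to P$ is a morphism of Poisson algebras, where $(\cdot_E,[-,-]_E)$ and $(\cdot'_E,[-,-]'_E)$ are equivalent if there is a Poisson algebra morphism $\varphi:(E,\cdot_E,[-,-]_E)\to(E,\cdot'_E,[-,-]'_E)$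 (necessarily an isomorphism) with $\varphi(x)=x$ for all $x\in V$ and $\pi\circ\varphi=\pi$. *)

theory Defs
  imports Complex_Main "HOL-Library.FuncSet"
begin

definition bilinear_on ::
  "('k::field \<Rightarrow> 'a::ab_group_add \<Rightarrow> 'a) \<Rightarrow> 'a set \<Rightarrow> ('k \<Rightarrow> 'b::ab_group_add \<Rightarrow> 'b) \<Rightarrow> 'b set \<Rightarrow>
   ('k \<Rightarrow> 'c::ab_group_add \<Rightarrow> 'c) \<Rightarrow> 'c set \<Rightarrow> ('a \<Rightarrow> 'b \<Rightarrow> 'c) \<Rightarrow> bool"
  where "bilinear_on sa A sb B sc C h \<longleftrightarrow>
    (\<forall>a\<in>A. \<forall>b\<in>B. h a b \<in> C) \<and>
    (\<forall>a\<in>A. \<forall>a'\<in>A. \<forall>b\<in>B. h (a + a') b = h a b + h a' b) \<and>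
    (\<forall>a\<in>A. \<forall>b\<in>B. \<forall>b'\<in>B. h a (b + b') = h a b + h a b') \<and>
    (\<forall>c. \<forall>a\<in>A. \<forall>b\<in>B. h (sa c a) b = sc c (h a b)) \<and>
    (\<forall>c. \<forall>a\<in>A. \<forall>b\<in>B. h a (sb c b) = sc c (h a b))"

text \<open>A Poisson algebra whose underlying space is the subspace \<open>A\<close>. The bracket is required to be
  alternating (not only antisymmetric), since the field may have characteristic 2.\<close>

locale poisson_algebra = vector_space scale
  for scale :: "'k::field \<Rightarrow> 'a::ab_group_add \<Rightarrow> 'a" +
  fixes A :: "'a set"
    and mul :: "'a \<Rightarrow> 'a \<Rightarrow> 'a" (infixl \<open>\<odot>\<close> 75)
    and br :: "'a \<Rightarrow> 'a \<Rightarrow> 'a" (\<open>\<lbrace>_,_\<rbrace>\<close>)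
  assumes subspace: "module.subspace scale A"
    and mul_bilinear: "bilinear_on scale A scale A scale A mul"
    and mul_assoc: "\<lbrakk>p \<in> A; q \<in> A; r \<in> A\<rbrakk> \<Longrightarrow> (p \<odot> q) \<odot> r = p \<odot> (q \<odot> r)"
    and br_bilinear: "bilinear_on scale A scale A scale A br"
    and br_alternating: "p \<in> A \<Longrightarrow> \<lbrace>p,p\<rbrace> = 0"
    and br_jacobi: "\<lbrakk>p \<in> A; q \<in> A; r \<in> A\<rbrakk> \<Longrightarrow> \<lbrace>p,\<lbrace>q,r\<rbrace>\<rbrace> + \<lbrace>q,\<lbrace>r,p\<rbrace>\<rbrace> + \<lbrace>r,\<lbrace>p,q\<rbrace>\<rbrace> = 0"
    and leibniz: "\<lbrakk>p \<in> A; q \<in> A; r \<in> A\<rbrakk> \<Longrightarrow> \<lbrace>p \<odot> q,r\<rbrace> = \<lbrace>p,r\<rbrace> \<odot> q + p \<odot> \<lbrace>q,r\<rbrace>"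

definition poisson_hom ::
  "('k::field \<Rightarrow> 'a::ab_group_add \<Rightarrow> 'a) \<Rightarrow> ('a \<Rightarrow> 'a \<Rightarrow> 'a) \<Rightarrow> ('a \<Rightarrow> 'a \<Rightarrow> 'a) \<Rightarrow>
   ('k \<Rightarrow> 'b::ab_group_add \<Rightarrow> 'b) \<Rightarrow> ('b \<Rightarrow> 'b \<Rightarrow> 'b) \<Rightarrow> ('b \<Rightarrow> 'b \<Rightarrow> 'b) \<Rightarrow> ('a \<Rightarrow> 'b) \<Rightarrow> bool"
  where "poisson_hom sa mula bra sb mulb brb h \<longleftrightarrow>
    Vector_Spaces.linear sa sb h \<and>
    (\<forall>x y. h (mula x y) = mulb (h x) (h y)) \<and>
    (\<forall>x y. h (bra x y) = brb (h x) (h y))"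

text \<open>The vector space \<open>V\<close> is a subspace of an ambient space \<open>'e\<close>. A map defined on \<open>V\<close> is
  represented by an extensional function (\<open>undefined\<close> outside \<open>V\<close>), so that equality of data is
  equality of the maps they represent.\<close>

locale precrossed_datum =
  fixes scaleP :: "'k::field \<Rightarrow> 'p::ab_group_add \<Rightarrow> 'p"
    and scaleE :: "'k \<Rightarrow> 'e::ab_group_add \<Rightarrow> 'e"
    and V :: "'e set"
    and lact :: "'p \<Rightarrow> 'e \<Rightarrow> 'e" (infixr \<open>\<rightharpoonup>\<close> 75)
    and ract :: "'e \<Rightarrow> 'p \<Rightarrow> 'e" (infixl \<open>\<triangleleft>\<close> 75)
    and \<theta> :: "'p \<Rightarrow> 'p \<Rightarrow> 'e"
    and mulV :: "'e \<Rightarrow> 'e \<Rightarrow> 'e" (infixl \<open>\<cdot>\<close> 75)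
    and lie_act :: "'p \<Rightarrow> 'e \<Rightarrow> 'e" (infixr \<open>\<triangleright>\<close> 75)
    and f :: "'p \<Rightarrow> 'p \<Rightarrow> 'e"
    and brV :: "'e \<Rightarrow> 'e \<Rightarrow> 'e" (\<open>\<lbrace>_,_\<rbrace>\<^sub>V\<close>)
  assumes lact_map: "lact \<in> UNIV \<rightarrow> (V \<rightarrow>\<^sub>E V)"
    and lact_bilinear: "bilinear_on scaleP UNIV scaleE V scaleE V lact"
    and ract_map: "ract \<in> V \<rightarrow>\<^sub>E (UNIV \<rightarrow> V)"
    and ract_bilinear: "bilinear_on scaleE V scaleP UNIV scaleE V ract"
    and \<theta>_bilinear: "bilinear_on scaleP UNIV scaleP UNIV scaleE V \<theta>"
    and mulV_map: "mulV \<in> V \<rightarrow>\<^sub>E (V \<rightarrow>\<^sub>E V)"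
    and mulV_bilinear: "bilinear_on scaleE V scaleE V scaleE V mulV"
    and lie_act_map: "lie_act \<in> UNIV \<rightarrow> (V \<rightarrow>\<^sub>E V)"
    and lie_act_bilinear: "bilinear_on scaleP UNIV scaleE V scaleE V lie_act"
    and f_bilinear: "bilinear_on scaleP UNIV scaleP UNIV scaleE V f"
    and brV_map: "brV \<in> V \<rightarrow>\<^sub>E (V \<rightarrow>\<^sub>E V)"
    and brV_bilinear: "bilinear_on scaleE V scaleE V scaleE V brV"

locale crossed_system =
  precrossed_datum scaleP scaleE V lact ract \<theta> mulV lie_act f brV
  for scaleP :: "'k::field \<Rightarrow> 'p::ab_group_add \<Rightarrow> 'p"
    and mulP :: "'p \<Rightarrow> 'p \<Rightarrow> 'p" (infixl \<open>\<odot>\<close> 75)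
    and brP :: "'p \<Rightarrow> 'p \<Rightarrow> 'p" (\<open>\<lbrace>_,_\<rbrace>\<^sub>P\<close>)
    and scaleE :: "'k \<Rightarrow> 'e::ab_group_add \<Rightarrow> 'e"
    and V :: "'e set"
    and lact :: "'p \<Rightarrow> 'e \<Rightarrow> 'e" (infixr \<open>\<rightharpoonup>\<close> 75)
    and ract :: "'e \<Rightarrow> 'p \<Rightarrow> 'e" (infixl \<open>\<triangleleft>\<close> 75)
    and \<theta> :: "'p \<Rightarrow> 'p \<Rightarrow> 'e"
    and mulV :: "'e \<Rightarrow> 'e \<Rightarrow> 'e" (infixl \<open>\<cdot>\<close> 75)
    and lie_act :: "'p \<Rightarrow> 'e \<Rightarrow> 'e" (infixr \<open>\<triangleright>\<close> 75)
    and f :: "'p \<Rightarrow> 'p \<Rightarrow> 'e"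
    and brV :: "'e \<Rightarrow> 'e \<Rightarrow> 'e" (\<open>\<lbrace>_,_\<rbrace>\<^sub>V\<close>) +
  assumes V_poisson: "poisson_algebra scaleE V mulV brV"
    and H1: "\<lbrakk>x \<in> V; y \<in> V\<rbrakk> \<Longrightarrow> (x \<cdot> y) \<triangleleft> p = x \<cdot> (y \<triangleleft> p)"
    and H2: "\<lbrakk>x \<in> V; y \<in> V\<rbrakk> \<Longrightarrow> (x \<triangleleft> p) \<cdot> y = x \<cdot> (p \<rightharpoonup> y)"
    and H3: "\<lbrakk>x \<in> V; y \<in> V\<rbrakk> \<Longrightarrow> p \<rightharpoonup> (x \<cdot> y) = (p \<rightharpoonup> x) \<cdot> y"
    and H4: "x \<in> V \<Longrightarrow> (p \<rightharpoonup> x) \<triangleleft> q = p \<rightharpoonup> (x \<triangleleft> q)"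
    and H5: "\<theta> p q \<triangleleft> r = \<theta> p (q \<odot> r) - \<theta> (p \<odot> q) r + p \<rightharpoonup> \<theta> q r"
    and H6: "x \<in> V \<Longrightarrow> (p \<odot> q) \<rightharpoonup> x = p \<rightharpoonup> (q \<rightharpoonup> x) - \<theta> p q \<cdot> x"
    and H7: "x \<in> V \<Longrightarrow> x \<triangleleft> (p \<odot> q) = (x \<triangleleft> p) \<triangleleft> q - x \<cdot> \<theta> p q"
    and L1: "f p p = 0"
    and L2: "\<lbrakk>x \<in> V; y \<in> V\<rbrakk> \<Longrightarrow> p \<triangleright> \<lbrace>x,y\<rbrace>\<^sub>V = \<lbrace>p \<triangleright> x,y\<rbrace>\<^sub>V + \<lbrace>x,p \<triangleright> y\<rbrace>\<^sub>V"
    and L3: "x \<in> V \<Longrightarrow> \<lbrace>p,q\<rbrace>\<^sub>P \<triangleright> x = p \<triangleright> (q \<triangleright> x) - q \<triangleright> (p \<triangleright> x) + \<lbrace>x,f p q\<rbrace>\<^sub>V"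
    and L4: "f p \<lbrace>q,r\<rbrace>\<^sub>P + f q \<lbrace>r,p\<rbrace>\<^sub>P + f r \<lbrace>p,q\<rbrace>\<^sub>P + p \<triangleright> f q r + q \<triangleright> f r p + r \<triangleright> f p q = 0"
    and P1: "f (p \<odot> q) r - f p r \<triangleleft> q - p \<rightharpoonup> f q r
             = r \<triangleright> \<theta> p q + \<theta> \<lbrace>p,r\<rbrace>\<^sub>P q + \<theta> p \<lbrace>q,r\<rbrace>\<^sub>P"
    and P2: "x \<in> V \<Longrightarrow> (p \<odot> q) \<triangleright> x = p \<rightharpoonup> (q \<triangleright> x) + (p \<triangleright> x) \<triangleleft> q - \<lbrace>\<theta> p q,x\<rbrace>\<^sub>V"
    and P3: "x \<in> V \<Longrightarrow> \<lbrace>p,q\<rbrace>\<^sub>P \<rightharpoonup> x = p \<rightharpoonup> (q \<triangleright> x) - q \<triangleright> (p \<rightharpoonup> x) - f p q \<cdot> x"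
    and P4: "\<lbrakk>x \<in> V; y \<in> V\<rbrakk> \<Longrightarrow> p \<rightharpoonup> \<lbrace>x,y\<rbrace>\<^sub>V = \<lbrace>p \<rightharpoonup> x,y\<rbrace>\<^sub>V - (p \<triangleright> y) \<cdot> x"
    and P5: "x \<in> V \<Longrightarrow> x \<triangleleft> \<lbrace>p,q\<rbrace>\<^sub>P = (q \<triangleright> x) \<triangleleft> p - q \<triangleright> (x \<triangleleft> p) - x \<cdot> f p q"
    and P6: "\<lbrakk>x \<in> V; y \<in> V\<rbrakk> \<Longrightarrow> \<lbrace>x,y\<rbrace>\<^sub>V \<triangleleft> p = \<lbrace>x \<triangleleft> p,y\<rbrace>\<^sub>V - x \<cdot> (p \<triangleright> y)"
    and P7: "\<lbrakk>x \<in> V; y \<in> V\<rbrakk> \<Longrightarrow> p \<triangleright> (x \<cdot> y) = (p \<triangleright> x) \<cdot> y + x \<cdot> (p \<triangleright> y)"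

text \<open>Seven-tuples \<open>(\<rightharpoonup>, \<triangleleft>, \<theta>, \<cdot>, \<triangleright>, f, [-,-])\<close>.\<close>

type_synonym ('p, 'e) datum =
  "('p \<Rightarrow> 'e \<Rightarrow> 'e) \<times> ('e \<Rightarrow> 'p \<Rightarrow> 'e) \<times> ('p \<Rightarrow> 'p \<Rightarrow> 'e) \<times> ('e \<Rightarrow> 'e \<Rightarrow> 'e) \<times>
   ('p \<Rightarrow> 'e \<Rightarrow> 'e) \<times> ('p \<Rightarrow> 'p \<Rightarrow> 'e) \<times> ('e \<Rightarrow> 'e \<Rightarrow> 'e)"

definition crossed_systems ::
  "('k::field \<Rightarrow> 'p::ab_group_add \<Rightarrow> 'p) \<Rightarrow> ('p \<Rightarrow> 'p \<Rightarrow> 'p) \<Rightarrow> ('p \<Rightarrow> 'p \<Rightarrow> 'p) \<Rightarrow>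
   ('k \<Rightarrow> 'e::ab_group_add \<Rightarrow> 'e) \<Rightarrow> 'e set \<Rightarrow> ('p, 'e) datum set"
  where "crossed_systems scaleP mulP brP scaleE V =
    {(lact, ract, \<theta>, mulV, lie_act, f, brV).
       crossed_system scaleP mulP brP scaleE V lact ract \<theta> mulV lie_act f brV}"

fun cohomologous ::
  "('k::field \<Rightarrow> 'p::ab_group_add \<Rightarrow> 'p) \<Rightarrow> ('p \<Rightarrow> 'p \<Rightarrow> 'p) \<Rightarrow> ('p \<Rightarrow> 'p \<Rightarrow> 'p) \<Rightarrow>
   ('k \<Rightarrow> 'e::ab_group_add \<Rightarrow> 'e) \<Rightarrow> 'e set \<Rightarrow> ('p, 'e) datum \<Rightarrow> ('p, 'e) datum \<Rightarrow> bool"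
  where "cohomologous scaleP mulP brP scaleE V
      (lact, ract, \<theta>, mulV, lie_act, f, brV) (lact', ract', \<theta>', mulV', lie_act', f', brV') \<longleftrightarrow>
    mulV = mulV' \<and> brV = brV' \<and>
    (\<exists>r. Vector_Spaces.linear scaleP scaleE r \<and> range r \<subseteq> V \<and>
      (\<forall>p. \<forall>x\<in>V. lact p x = lact' p x + mulV (r p) x) \<and>
      (\<forall>p. \<forall>x\<in>V. ract x p = ract' x p + mulV x (r p)) \<and>
      (\<forall>p q. \<theta> p q = \<theta>' p q + lact' p (r q) + ract' (r p) q - r (mulP p q) + mulV (r p) (r q)) \<and>
      (\<forall>p. \<forall>x\<in>V. lie_act p x = lie_act' p x + brV (r p) x) \<and>
      (\<forall>p q. f p q = f' p q + lie_act' p (r q) - lie_act' q (r p) + brV (r p) (r q) - r (brP p q)))"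

definition cohomology_rel ::
  "('k::field \<Rightarrow> 'p::ab_group_add \<Rightarrow> 'p) \<Rightarrow> ('p \<Rightarrow> 'p \<Rightarrow> 'p) \<Rightarrow> ('p \<Rightarrow> 'p \<Rightarrow> 'p) \<Rightarrow>
   ('k \<Rightarrow> 'e::ab_group_add \<Rightarrow> 'e) \<Rightarrow> 'e set \<Rightarrow> (('p, 'e) datum \<times> ('p, 'e) datum) set"
  where "cohomology_rel scaleP mulP brP scaleE V =
    {(\<Omega>, \<Omega>'). \<Omega> \<in> crossed_systems scaleP mulP brP scaleE V \<and>
       \<Omega>' \<in> crossed_systems scaleP mulP brP scaleE V \<and>
       cohomologous scaleP mulP brP scaleE V \<Omega> \<Omega>'}"

definition GPH2 ::
  "('k::field \<Rightarrow> 'p::ab_group_add \<Rightarrow> 'p) \<Rightarrow> ('p \<Rightarrow> 'p \<Rightarrow> 'p) \<Rightarrow> ('p \<Rightarrow> 'p \<Rightarrow> 'p) \<Rightarrow>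
   ('k \<Rightarrow> 'e::ab_group_add \<Rightarrow> 'e) \<Rightarrow> 'e set \<Rightarrow> ('p, 'e) datum set set"
  where "GPH2 scaleP mulP brP scaleE V =
    crossed_systems scaleP mulP brP scaleE V // cohomology_rel scaleP mulP brP scaleE V"

fun crossed_mult :: "('p \<Rightarrow> 'p \<Rightarrow> 'p) \<Rightarrow> ('p, 'e::ab_group_add) datum \<Rightarrow> 'p \<times> 'e \<Rightarrow> 'p \<times> 'e \<Rightarrow> 'p \<times> 'e"
  where "crossed_mult mulP (lact, ract, \<theta>, mulV, lie_act, f, brV) (p, x) (q, y) =
    (mulP p q, \<theta> p q + lact p y + ract x q + mulV x y)"

fun crossed_bracket :: "('p \<Rightarrow> 'p \<Rightarrow> 'p) \<Rightarrow> ('p, 'e::ab_group_add) datum \<Rightarrow> 'p \<times> 'e \<Rightarrow> 'p \<times> 'e \<Rightarrow> 'p \<times> 'e"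
  where "crossed_bracket brP (lact, ract, \<theta>, mulV, lie_act, f, brV) (p, x) (q, y) =
    (brP p q, f p q + lie_act p y - lie_act q x + brV x y)"

text \<open>Poisson algebra structures on the whole of \<open>'e\<close> for which \<open>\<pi>\<close> is a Poisson morphism.\<close>

definition ext_structures ::
  "('k::field \<Rightarrow> 'p::ab_group_add \<Rightarrow> 'p) \<Rightarrow> ('p \<Rightarrow> 'p \<Rightarrow> 'p) \<Rightarrow> ('p \<Rightarrow> 'p \<Rightarrow> 'p) \<Rightarrow>
   ('k \<Rightarrow> 'e::ab_group_add \<Rightarrow> 'e) \<Rightarrow> ('e \<Rightarrow> 'p) \<Rightarrow> (('e \<Rightarrow> 'e \<Rightarrow> 'e) \<times> ('e \<Rightarrow> 'e \<Rightarrow> 'e)) set"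
  where "ext_structures scaleP mulP brP scaleE \<pi> =
    {(mulE, brE). poisson_algebra scaleE UNIV mulE brE \<and>
       poisson_hom scaleE mulE brE scaleP mulP brP \<pi>}"

definition ext_equiv_rel ::
  "('k::field \<Rightarrow> 'p::ab_group_add \<Rightarrow> 'p) \<Rightarrow> ('p \<Rightarrow> 'p \<Rightarrow> 'p) \<Rightarrow> ('p \<Rightarrow> 'p \<Rightarrow> 'p) \<Rightarrow>
   ('k \<Rightarrow> 'e::ab_group_add \<Rightarrow> 'e) \<Rightarrow> ('e \<Rightarrow> 'p) \<Rightarrow>
   ((('e \<Rightarrow> 'e \<Rightarrow> 'e) \<times> ('e \<Rightarrow> 'e \<Rightarrow> 'e)) \<times> (('e \<Rightarrow> 'e \<Rightarrow> 'e) \<times> ('e \<Rightarrow> 'e \<Rightarrow> 'e))) set"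
  where "ext_equiv_rel scaleP mulP brP scaleE \<pi> =
    {((mulE, brE), (mulE', brE')).
       (mulE, brE) \<in> ext_structures scaleP mulP brP scaleE \<pi> \<and>
       (mulE', brE') \<in> ext_structures scaleP mulP brP scaleE \<pi> \<and>
       (\<exists>\<phi>. poisson_hom scaleE mulE brE scaleE mulE' brE' \<phi> \<and>
          (\<forall>x. \<pi> x = 0 \<longrightarrow> \<phi> x = x) \<and> \<pi> \<circ> \<phi> = \<pi>)}"

definition Gext ::
  "('k::field \<Rightarrow> 'p::ab_group_add \<Rightarrow> 'p) \<Rightarrow> ('p \<Rightarrow> 'p \<Rightarrow> 'p) \<Rightarrow> ('p \<Rightarrow> 'p \<Rightarrow> 'p) \<Rightarrow>
   ('k \<Rightarrow> 'e::ab_group_add \<Rightarrow> 'e) \<Rightarrow> ('e \<Rightarrow> 'p) \<Rightarrow> (('e \<Rightarrow> 'e \<Rightarrow> 'e) \<times> ('e \<Rightarrow> 'e \<Rightarrow> 'e)) set set"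
  where "Gext scaleP mulP brP scaleE \<pi> =
    ext_structures scaleP mulP brP scaleE \<pi> // ext_equiv_rel scaleP mulP brP scaleE \<pi>"

definition linear_section ::
  "('k::field \<Rightarrow> 'p::ab_group_add \<Rightarrow> 'p) \<Rightarrow> ('k \<Rightarrow> 'e::ab_group_add \<Rightarrow> 'e) \<Rightarrow> ('e \<Rightarrow> 'p) \<Rightarrow> ('p \<Rightarrow> 'e) \<Rightarrow> bool"
  where "linear_section scaleP scaleE \<pi> s \<longleftrightarrow>
    Vector_Spaces.linear scaleP scaleE s \<and> (\<forall>p. \<pi> (s p) = p)"

lemma linear_section_exists:
  assumes "Vector_Spaces.linear scaleE scaleP \<pi>" and "surj \<pi>"
  shows "\<exists>s. linear_section scaleP scaleE \<pi> s"
proof -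
  interpret lin: Vector_Spaces.linear scaleE scaleP \<pi> by (fact assms(1))
  interpret pair: vector_space_pair scaleE scaleP ..
  show ?thesis
    using pair.linear_surj_right_inverse[OF assms(1), of UNIV UNIV] assms(2)
    by (auto simp: linear_section_def)
qed

definition glue :: "('p \<Rightarrow> 'e::ab_group_add) \<Rightarrow> 'p \<times> 'e \<Rightarrow> 'e"
  where "glue s = (\<lambda>(p, x). s p + x)"

text \<open>Transport of a binary operation along \<open>glue s : P \<times> V \<rightarrow> E\<close>, which is bijective when \<open>s\<close> is a
  linear section of \<open>\<pi>\<close> and \<open>V\<close> is the kernel of \<open>\<pi>\<close>.\<close>

definition transport :: "'e set \<Rightarrow> ('p \<Rightarrow> 'e) \<Rightarrow> ('p \<times> 'e \<Rightarrow> 'p \<times> 'e \<Rightarrow> 'p \<times> 'e) \<Rightarrow> 'e::ab_group_add \<Rightarrow> 'e \<Rightarrow> 'e"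
  where "transport V s op u v =
    glue s (op (the_inv_into (UNIV \<times> V) (glue s) u) (the_inv_into (UNIV \<times> V) (glue s) v))"

definition crossed_product_on ::
  "('p \<Rightarrow> 'p \<Rightarrow> 'p) \<Rightarrow> ('p \<Rightarrow> 'p \<Rightarrow> 'p) \<Rightarrow> 'e set \<Rightarrow> ('p \<Rightarrow> 'e::ab_group_add) \<Rightarrow> ('p, 'e) datum \<Rightarrow>
   ('e \<Rightarrow> 'e \<Rightarrow> 'e) \<times> ('e \<Rightarrow> 'e \<Rightarrow> 'e)"
  where "crossed_product_on mulP brP V s \<Omega> =
    (transport V s (crossed_mult mulP \<Omega>), transport V s (crossed_bracket brP \<Omega>))"

end

theory Submission
  imports Defs
begin

text \<open>Call a Poisson algebra structure on \<open>E\<close> for which \<open>\<pi>\<close> is a morphism an extension structure, and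
  fix a linear section \<open>s\<close> of \<open>\<pi>\<close>. Every element of \<open>E\<close> is uniquely \<open>s p + x\<close> with \<open>x\<close> in the kernel
  \<open>V\<close>, so a bilinear operation on \<open>E\<close> that \<open>\<pi>\<close> carries to the operation of \<open>P\<close> is the same as a
  family of bilinear maps: its values on \<open>s P \<times> V\<close>, \<open>V \<times> s P\<close> and \<open>V \<times> V\<close>, and the defect of \<open>s\<close> from
  being multiplicative on \<open>s P \<times> s P\<close>. For an alternating bracket the values on \<open>V \<times> s P\<close> are
  determined by those on \<open>s P \<times> V\<close>. Splitting each argument of associativity, Jacobi and Leibniz
  along \<open>E = s P \<oplus> V\<close> turns these laws into exactly the axioms of a crossed system. This is used in
  both directions, in \<open>crossed_product_in_exts\<close> and \<open>datum_of_crossed_system\<close>, and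
  \<open>crossed_product_on_datum_of\<close> says that every extension structure is the crossed product of its
  datum.

  A linear map \<open>\<phi>\<close> on \<open>E\<close> that is the identity on \<open>V\<close> and lies over \<open>P\<close> has the form
  \<open>\<phi> (s p + x) = s p + (r p + x)\<close> for a unique linear \<open>r : P \<rightarrow> V\<close>. Expanding the requirement that
  \<open>\<phi>\<close> be a morphism between two crossed products gives the equations by which \<open>r\<close> makes the two
  systems cohomologous (\<open>cohomologous_iff_equivalent\<close>). So cohomology is the pullback, along the
  crossed product map, of equivalence of extension structures. The latter is an equivalence relation
  (\<open>equiv_ext_rel\<close>) and the map is surjective, which gives the equivalence relation and the
  bijection of quotients formally (\<open>equiv_pullback_quotient_bij\<close>). Two sections give equivalent
  crossed products (\<open>crossed_product_on_section_independent\<close>), so the bijection does not depend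
  on \<open>s\<close>.\<close>

section \<open>Bilinear maps on subspaces\<close>

lemma bilinear_on_diff_left:
  assumes "bilinear_on sa A sb B sc C h" "a - a' \<in> A" "a' \<in> A" "b \<in> B"
  shows "h (a - a') b = h a b - h a' b"
proof -
  have "h ((a - a') + a') b = h (a - a') b + h a' b"
    using assms unfolding bilinear_on_def by blast
  then show ?thesis by (simp add: algebra_simps)
qed

lemma bilinear_on_diff_right:
  assumes "bilinear_on sa A sb B sc C h" "a \<in> A" "b - b' \<in> B" "b' \<in> B"
  shows "h a (b - b') = h a b - h a b'"
proof -
  have "h a ((b - b') + b') = h a (b - b') + h a b'"
    using assms unfolding bilinear_on_def by blast
  then show ?thesis by (simp add: algebra_simps)
qed

lemma bilinear_on_rules:
  assumes "bilinear_on sa A sb B sc C h"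
  shows bilinear_on_in: "a \<in> A \<Longrightarrow> b \<in> B \<Longrightarrow> h a b \<in> C"
    and bilinear_on_add_left: "a \<in> A \<Longrightarrow> a' \<in> A \<Longrightarrow> b \<in> B \<Longrightarrow> h (a + a') b = h a b + h a' b"
    and bilinear_on_add_right: "a \<in> A \<Longrightarrow> b \<in> B \<Longrightarrow> b' \<in> B \<Longrightarrow> h a (b + b') = h a b + h a b'"
    and bilinear_on_scale_left: "a \<in> A \<Longrightarrow> b \<in> B \<Longrightarrow> h (sa c a) b = sc c (h a b)"
    and bilinear_on_scale_right: "a \<in> A \<Longrightarrow> b \<in> B \<Longrightarrow> h a (sb c b) = sc c (h a b)"
  using assms unfolding bilinear_on_def by blast+

lemma bilinear_on_zero_left:
  assumes "bilinear_on sa A sb B sc C h" "0 \<in> A" "b \<in> B"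
  shows "h 0 b = 0"
  using bilinear_on_diff_left[OF assms(1), of 0 0 b] assms by simp

lemma bilinear_on_zero_right:
  assumes "bilinear_on sa A sb B sc C h" "a \<in> A" "0 \<in> B"
  shows "h a 0 = 0"
  using bilinear_on_diff_right[OF assms(1), of a 0 0] assms by simp

lemma bilinear_on_minus_left:
  assumes "bilinear_on sa A sb B sc C h" "- a \<in> A" "0 \<in> A" "a \<in> A" "b \<in> B"
  shows "h (- a) b = - h a b"
  using bilinear_on_diff_left[OF assms(1), of 0 a b] bilinear_on_zero_left[OF assms(1)] assms by simp

lemma bilinear_on_minus_right:
  assumes "bilinear_on sa A sb B sc C h" "a \<in> A" "- b \<in> B" "0 \<in> B" "b \<in> B"
  shows "h a (- b) = - h a b"
  using bilinear_on_diff_right[OF assms(1), of a 0 b] bilinear_on_zero_right[OF assms(1)] assms by simp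

lemmas bilinear_on_simps = bilinear_on_rules bilinear_on_minus_left bilinear_on_minus_right
  bilinear_on_diff_left bilinear_on_diff_right bilinear_on_zero_left bilinear_on_zero_right

section \<open>Rules for Poisson algebras and crossed systems\<close>

context poisson_algebra
begin

lemmas mul_simps = bilinear_on_simps[OF mul_bilinear]
lemmas br_simps = bilinear_on_simps[OF br_bilinear]

lemma br_antisym:
  assumes "p \<in> A" "q \<in> A"
  shows "\<lbrace>p,q\<rbrace> = - \<lbrace>q,p\<rbrace>"
proof -
  have "p + q \<in> A" using assms subspace by (simp add: subspace_add)
  then have "\<lbrace>p + q,p + q\<rbrace> = 0" by (rule br_alternating)
  then have "\<lbrace>p,p\<rbrace> + \<lbrace>p,q\<rbrace> + (\<lbrace>q,p\<rbrace> + \<lbrace>q,q\<rbrace>) = 0"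
    using assms \<open>p + q \<in> A\<close> by (simp add: br_simps add_ac)
  then have "\<lbrace>p,q\<rbrace> + \<lbrace>q,p\<rbrace> = 0"
    using assms by (simp add: br_alternating)
  then show ?thesis by (simp add: eq_neg_iff_add_eq_0)
qed

end

context crossed_system
begin

lemmas lact_simps = bilinear_on_simps[OF lact_bilinear]
lemmas ract_simps = bilinear_on_simps[OF ract_bilinear]
lemmas \<theta>_simps = bilinear_on_simps[OF \<theta>_bilinear]
lemmas mulV_simps = bilinear_on_simps[OF mulV_bilinear]
lemmas lie_act_simps = bilinear_on_simps[OF lie_act_bilinear]
lemmas f_simps = bilinear_on_simps[OF f_bilinear]
lemmas brV_simps = bilinear_on_simps[OF brV_bilinear]

lemmas datum_simps = lact_simps ract_simps \<theta>_simps mulV_simps lie_act_simps f_simps brV_simps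

lemma V_closed:
  shows "0 \<in> V" "x \<in> V \<Longrightarrow> y \<in> V \<Longrightarrow> x + y \<in> V" "x \<in> V \<Longrightarrow> y \<in> V \<Longrightarrow> x - y \<in> V"
    "x \<in> V \<Longrightarrow> - x \<in> V" "x \<in> V \<Longrightarrow> scaleE c x \<in> V"
proof -
  interpret V: poisson_algebra scaleE V mulV brV by (rule V_poisson)
  show "0 \<in> V" "x \<in> V \<Longrightarrow> y \<in> V \<Longrightarrow> x + y \<in> V" "x \<in> V \<Longrightarrow> y \<in> V \<Longrightarrow> x - y \<in> V"
    "x \<in> V \<Longrightarrow> - x \<in> V" "x \<in> V \<Longrightarrow> scaleE c x \<in> V"
    using V.subspace
    by (simp_all add: V.subspace_0 V.subspace_add V.subspace_diff V.subspace_neg V.subspace_scale)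
qed

end

section \<open>Equivalence of extension structures\<close>

locale vector_space_extension =
  P: poisson_algebra scaleP UNIV mulP brP +
  E: vector_space scaleE +
  proj: Vector_Spaces.linear scaleE scaleP \<pi>
  for scaleP :: "'k::field \<Rightarrow> 'p::ab_group_add \<Rightarrow> 'p"
    and mulP :: "'p \<Rightarrow> 'p \<Rightarrow> 'p" (infixl \<open>\<odot>\<close> 75)
    and brP :: "'p \<Rightarrow> 'p \<Rightarrow> 'p" (\<open>\<lbrace>_,_\<rbrace>\<^sub>P\<close>)
    and scaleE :: "'k \<Rightarrow> 'e::ab_group_add \<Rightarrow> 'e"
    and \<pi> :: "'e \<Rightarrow> 'p" +
  fixes V :: "'e set"
  assumes V_kernel: "V = {x. \<pi> x = 0}"
begin

abbreviation "exts \<equiv> ext_structures scaleP mulP brP scaleE \<pi>"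
abbreviation "ext_rel \<equiv> ext_equiv_rel scaleP mulP brP scaleE \<pi>"
abbreviation "systems \<equiv> crossed_systems scaleP mulP brP scaleE V"
abbreviation "coh_rel \<equiv> cohomology_rel scaleP mulP brP scaleE V"

lemma in_V_iff: "x \<in> V \<longleftrightarrow> \<pi> x = 0"
  by (simp add: V_kernel)

text \<open>Only symmetry needs an idea: a morphism \<open>\<phi>\<close> over \<open>P\<close> that fixes \<open>V\<close> moves each \<open>u\<close> by an element
  \<open>\<phi> u - u\<close> of \<open>V\<close>, which \<open>\<phi>\<close> fixes, so moving back by the same element inverts \<open>\<phi>\<close>.\<close>

lemma equiv_ext_rel: "equiv exts ext_rel"
proof (rule equivI)
  show "ext_rel \<subseteq> exts \<times> exts"
    by (auto simp: ext_equiv_rel_def)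
  show "refl_on exts ext_rel"
  proof (rule refl_onI)
    fix S assume "S \<in> exts"
    moreover have "Vector_Spaces.linear scaleE scaleE id"
      by (rule E.linear_id)
    ultimately show "(S, S) \<in> ext_rel"
      by (cases S) (auto simp: ext_equiv_rel_def poisson_hom_def intro!: exI[of _ id])
  qed
  show "sym ext_rel"
  proof (rule symI)
    fix S S' assume "(S, S') \<in> ext_rel"
    then obtain m b m' b' \<phi> where S: "S = (m, b)" "S' = (m', b')"
      and in_exts: "(m, b) \<in> exts" "(m', b') \<in> exts"
      and hom: "poisson_hom scaleE m b scaleE m' b' \<phi>"
      and fix_V: "\<And>x. \<pi> x = 0 \<Longrightarrow> \<phi> x = x" and "\<pi> \<circ> \<phi> = \<pi>"
      by (auto simp: ext_equiv_rel_def)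
    then have over_P: "\<pi> (\<phi> x) = \<pi> x" for x
      by (simp add: fun_eq_iff)
    interpret \<phi>: Vector_Spaces.linear scaleE scaleE \<phi>
      using hom by (simp add: poisson_hom_def)
    define \<psi> where "\<psi> u = u - (\<phi> u - u)" for u
    have shift: "\<phi> (\<phi> u - u) = \<phi> u - u" for u
      by (rule fix_V) (simp add: proj.diff over_P)
    have \<phi>\<psi>: "\<phi> (\<psi> u) = u" for u
      unfolding \<psi>_def \<phi>.diff[of u "\<phi> u - u"] shift by simp
    have \<psi>\<phi>: "\<psi> (\<phi> u) = u" for u
      using shift[of u] by (simp add: \<psi>_def \<phi>.diff)
    have "Vector_Spaces.linear scaleE scaleE \<psi>"
      by unfold_locales
        (simp_all add: \<psi>_def \<phi>.add \<phi>.scale E.scale_right_diff_distrib algebra_simps)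
    moreover have "\<psi> (m' x y) = m (\<psi> x) (\<psi> y)" "\<psi> (b' x y) = b (\<psi> x) (\<psi> y)" for x y
      using hom unfolding poisson_hom_def by (metis \<phi>\<psi> \<psi>\<phi>)+
    ultimately have "poisson_hom scaleE m' b' scaleE m b \<psi>"
      by (simp add: poisson_hom_def)
    moreover have "\<forall>x. \<pi> x = 0 \<longrightarrow> \<psi> x = x" "\<pi> \<circ> \<psi> = \<pi>"
      by (auto simp: \<psi>_def fix_V fun_eq_iff proj.diff over_P)
    ultimately show "(S', S) \<in> ext_rel"
      using in_exts unfolding ext_equiv_rel_def S by blast
  qed
  show "trans ext_rel"
  proof (rule transI)
    fix S S' S'' assume "(S, S') \<in> ext_rel" "(S', S'') \<in> ext_rel"
    then obtain m b m' b' m'' b'' \<phi> \<psi> where S: "S = (m, b)" "S' = (m', b')" "S'' = (m'', b'')"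
      and in_exts: "(m, b) \<in> exts" "(m'', b'') \<in> exts"
      and hom: "poisson_hom scaleE m b scaleE m' b' \<phi>" "poisson_hom scaleE m' b' scaleE m'' b'' \<psi>"
      and fix_V: "\<And>x. \<pi> x = 0 \<Longrightarrow> \<phi> x = x" "\<And>x. \<pi> x = 0 \<Longrightarrow> \<psi> x = x"
      and over_P: "\<pi> \<circ> \<phi> = \<pi>" "\<pi> \<circ> \<psi> = \<pi>"
      by (auto simp: ext_equiv_rel_def)
    have "poisson_hom scaleE m b scaleE m'' b'' (\<psi> \<circ> \<phi>)"
      using hom by (auto simp: poisson_hom_def intro: Vector_Spaces.linear_compose)
    moreover have "\<forall>x. \<pi> x = 0 \<longrightarrow> (\<psi> \<circ> \<phi>) x = x" "\<pi> \<circ> (\<psi> \<circ> \<phi>) = \<pi>"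
      using over_P by (auto simp: fix_V fun_eq_iff)
    ultimately show "(S, S'') \<in> ext_rel"
      using in_exts unfolding ext_equiv_rel_def S by blast
  qed
qed

end

section \<open>The crossed system of an extension structure\<close>

locale split_extension = vector_space_extension scaleP mulP brP scaleE \<pi> V
  for scaleP :: "'k::field \<Rightarrow> 'p::ab_group_add \<Rightarrow> 'p"
    and mulP :: "'p \<Rightarrow> 'p \<Rightarrow> 'p" (infixl \<open>\<odot>\<close> 75)
    and brP :: "'p \<Rightarrow> 'p \<Rightarrow> 'p" (\<open>\<lbrace>_,_\<rbrace>\<^sub>P\<close>)
    and scaleE :: "'k \<Rightarrow> 'e::ab_group_add \<Rightarrow> 'e"
    and \<pi> :: "'e \<Rightarrow> 'p"
    and V :: "'e set" +
  fixes s :: "'p \<Rightarrow> 'e"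
  assumes is_section: "linear_section scaleP scaleE \<pi> s"
begin

sublocale s: Vector_Spaces.linear scaleP scaleE s
  using is_section by (simp add: linear_section_def)

lemma \<pi>_s: "\<pi> (s p) = p"
  using is_section by (simp add: linear_section_def)

lemma \<pi>_decompose: "x \<in> V \<Longrightarrow> \<pi> (s p + x) = p"
  by (simp add: proj.add \<pi>_s in_V_iff)

lemma decompose:
  obtains p x where "x \<in> V" "u = s p + x"
proof
  show "u - s (\<pi> u) \<in> V" by (simp add: in_V_iff proj.diff \<pi>_s)
  show "u = s (\<pi> u) + (u - s (\<pi> u))" by simp
qed

lemma add_decomposed: "(s p + x) + (s q + y) = s (p + q) + (x + y)"
  by (simp add: s.add algebra_simps)

lemma scale_decomposed: "scaleE c (s p + x) = s (scaleP c p) + scaleE c x"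
  by (simp add: s.scale E.scale_right_distrib)

text \<open>All computations with transported operations go through this rule, which evaluates them on split
  elements and so avoids the inverse of \<open>glue s\<close>.\<close>

lemma transport_decomposed:
  assumes "x \<in> V" "y \<in> V"
  shows "transport V s op (s p + x) (s q + y) = glue s (op (p, x) (q, y))"
proof -
  have "inj_on (glue s) (UNIV \<times> V)"
  proof (rule inj_onI, clarsimp simp: glue_def)
    fix p x q y assume eq: "s p + x = s q + y" and V: "x \<in> V" "y \<in> V"
    from arg_cong[OF eq, of \<pi>] V have "p = q" by (simp add: \<pi>_decompose)
    with eq show "p = q \<and> x = y" by simp
  qed
  then have inverse: "the_inv_into (UNIV \<times> V) (glue s) (s p + x) = (p, x)" if "x \<in> V" for p x
    using the_inv_into_f_f[of "glue s" "UNIV \<times> V" "(p, x)"] that by (simp add: glue_def)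
  show ?thesis by (simp add: transport_def inverse assms)
qed

text \<open>The cocycles \<open>\<theta>\<close> and \<open>f\<close> measure how far the section is from being a morphism of Poisson algebras;
  the other components are the operations of \<open>E\<close> with an argument from \<open>P\<close> replaced by its lift. The
  restrictions make the components extensional.\<close>

definition datum_of :: "('e \<Rightarrow> 'e \<Rightarrow> 'e) \<Rightarrow> ('e \<Rightarrow> 'e \<Rightarrow> 'e) \<Rightarrow> ('p, 'e) datum"
  where "datum_of m b =
    (\<lambda>p. \<lambda>x\<in>V. m (s p) x, \<lambda>x\<in>V. \<lambda>p. m x (s p), \<lambda>p q. m (s p) (s q) - s (p \<odot> q), \<lambda>x\<in>V. \<lambda>y\<in>V. m x y,
     \<lambda>p. \<lambda>x\<in>V. b (s p) x, \<lambda>p q. b (s p) (s q) - s \<lbrace>p,q\<rbrace>\<^sub>P, \<lambda>x\<in>V. \<lambda>y\<in>V. b x y)"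

text \<open>Apart from \<open>L1\<close>, each axiom is associativity, Jacobi or Leibniz in \<open>E\<close> for three arguments taken
  from \<open>s P\<close> or \<open>V\<close>. The terms \<open>s (p \<odot> q)\<close> and \<open>s \<lbrace>p,q\<rbrace>\<^sub>P\<close> subtracted in the cocycles cancel against
  those coming from \<open>(p \<odot> q) \<rightharpoonup> x\<close>, \<open>\<lbrace>p,q\<rbrace>\<^sub>P \<triangleright> x\<close> and the like, or by the same law in \<open>P\<close>.\<close>

lemma datum_of_crossed_system:
  assumes "(m, b) \<in> exts"
  shows "datum_of m b \<in> systems"
proof -
  interpret S: poisson_algebra scaleE UNIV m b
    using assms by (simp add: ext_structures_def)
  have \<pi>_m: "\<pi> (m u v) = \<pi> u \<odot> \<pi> v" and \<pi>_b: "\<pi> (b u v) = \<lbrace>\<pi> u,\<pi> v\<rbrace>\<^sub>P" for u v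
    using assms by (auto simp: ext_structures_def poisson_hom_def)
  note P_simps = P.mul_simps[simplified] P.br_simps[simplified]
  note S_simps = S.mul_simps[simplified] S.br_simps[simplified]
  have S_assoc: "m (m u v) w = m u (m v w)" for u v w by (simp add: S.mul_assoc)
  have S_leibniz: "b (m u v) w = m (b u w) v + m u (b v w)" for u v w by (simp add: S.leibniz)
  have S_anti: "b u v = - b v u" for u v by (rule S.br_antisym) simp_all
  \<comment> \<open>Leibniz and Jacobi read as derivation rules. As rewrite rules they push brackets inwards and
    nest them to the right.\<close>
  have S_der: "b w (m u v) = m (b w u) v + m u (b w v)" for u v w
    using S_leibniz[of u v w] S_anti[of w "m u v"] S_anti[of w u] S_anti[of w v]
    by (simp add: S_simps algebra_simps)
  have S_jacobi: "b (b u v) w = b u (b v w) - b v (b u w)" for u v w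
    using S.br_jacobi[of u v w] S_anti[of "b u v" w] S_anti[of w u]
    by (simp add: S_simps algebra_simps)
  have P_jacobi: "s \<lbrace>p,\<lbrace>q,r\<rbrace>\<^sub>P\<rbrace>\<^sub>P + s \<lbrace>q,\<lbrace>r,p\<rbrace>\<^sub>P\<rbrace>\<^sub>P + s \<lbrace>r,\<lbrace>p,q\<rbrace>\<^sub>P\<rbrace>\<^sub>P = 0" for p q r
    using P.br_jacobi[of p q r] by (simp flip: s.add)
  have V_subspace: "E.subspace V"
    unfolding V_kernel by (rule proj.subspace_kernel)
  note V_closed = V_subspace[THEN E.subspace_add] V_subspace[THEN E.subspace_scale]
  have in_V: "m (s p) x \<in> V" "m x (s p) \<in> V" "m x y \<in> V" "b (s p) x \<in> V" "b x y \<in> V"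
    if "x \<in> V" "y \<in> V" for p x y
    using that by (simp_all add: in_V_iff \<pi>_m \<pi>_b P_simps)
  have cocycle_in_V: "m (s p) (s q) - s (p \<odot> q) \<in> V" "b (s p) (s q) - s \<lbrace>p,q\<rbrace>\<^sub>P \<in> V" for p q
    by (simp_all add: in_V_iff proj.diff \<pi>_m \<pi>_b \<pi>_s)
  have V_poisson: "poisson_algebra scaleE V (\<lambda>x\<in>V. \<lambda>y\<in>V. m x y) (\<lambda>x\<in>V. \<lambda>y\<in>V. b x y)"
    by unfold_locales
      (auto simp: bilinear_on_def V_subspace V_closed in_V S_simps S_assoc S_leibniz
        S.br_alternating S.br_jacobi)
  have "crossed_system scaleP mulP brP scaleE V (\<lambda>p. \<lambda>x\<in>V. m (s p) x) (\<lambda>x\<in>V. \<lambda>p. m x (s p))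
    (\<lambda>p q. m (s p) (s q) - s (p \<odot> q)) (\<lambda>x\<in>V. \<lambda>y\<in>V. m x y)
    (\<lambda>p. \<lambda>x\<in>V. b (s p) x) (\<lambda>p q. b (s p) (s q) - s \<lbrace>p,q\<rbrace>\<^sub>P) (\<lambda>x\<in>V. \<lambda>y\<in>V. b x y)"
    apply (intro crossed_system.intro precrossed_datum.intro crossed_system_axioms.intro V_poisson)
    apply (auto simp: bilinear_on_def V_closed in_V cocycle_in_V S_simps P_simps s.add s.scale
        E.scale_right_diff_distrib S_assoc S_leibniz S_der S_jacobi P.mul_assoc S.br_alternating
        P.br_alternating P.leibniz algebra_simps)
    \<comment> \<open>What remains is \<open>L4\<close>, which needs the cyclic Jacobi identity, and \<open>L3\<close>, \<open>P1\<close>, \<open>P3\<close>, \<open>P5\<close>, which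
      need antisymmetry.\<close>
    subgoal for x p q
      using S_anti[of x "s \<lbrace>p,q\<rbrace>\<^sub>P"] S_anti[of x "b (s p) (s q)"]
      by (simp add: S_jacobi algebra_simps)
    subgoal for p q r
      using S.br_jacobi[of "s p" "s q" "s r"] P_jacobi[of p q r] by (simp add: add.assoc)
    subgoal for p q r
      using S_anti[of "s r" "s (p \<odot> q)"] S_anti[of "s r" "s p"] S_anti[of "s r" "s q"]
      by (simp add: S_simps)
    subgoal for x p q
      using S_anti[of "s q" "s p"] by (simp add: S_simps)
    subgoal for x p q
      using S_anti[of "s q" "s p"] by (simp add: S_simps)
    done
  then show ?thesis
    by (simp add: crossed_systems_def datum_of_def)
qed

end

section \<open>The extension structure of a crossed system\<close>

locale split_crossed_system =
  split_extension scaleP mulP brP scaleE \<pi> V s +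
  crossed_system scaleP mulP brP scaleE V lact ract \<theta> mulV lie_act f brV
  for scaleP :: "'k::field \<Rightarrow> 'p::ab_group_add \<Rightarrow> 'p"
    and mulP :: "'p \<Rightarrow> 'p \<Rightarrow> 'p" (infixl \<open>\<odot>\<close> 75)
    and brP :: "'p \<Rightarrow> 'p \<Rightarrow> 'p" (\<open>\<lbrace>_,_\<rbrace>\<^sub>P\<close>)
    and scaleE :: "'k \<Rightarrow> 'e::ab_group_add \<Rightarrow> 'e"
    and \<pi> :: "'e \<Rightarrow> 'p"
    and V :: "'e set"
    and s :: "'p \<Rightarrow> 'e"
    and lact :: "'p \<Rightarrow> 'e \<Rightarrow> 'e" (infixr \<open>\<rightharpoonup>\<close> 75)
    and ract :: "'e \<Rightarrow> 'p \<Rightarrow> 'e" (infixl \<open>\<triangleleft>\<close> 75)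
    and \<theta> :: "'p \<Rightarrow> 'p \<Rightarrow> 'e"
    and mulV :: "'e \<Rightarrow> 'e \<Rightarrow> 'e" (infixl \<open>\<cdot>\<close> 75)
    and lie_act :: "'p \<Rightarrow> 'e \<Rightarrow> 'e" (infixr \<open>\<triangleright>\<close> 75)
    and f :: "'p \<Rightarrow> 'p \<Rightarrow> 'e"
    and brV :: "'e \<Rightarrow> 'e \<Rightarrow> 'e" (\<open>\<lbrace>_,_\<rbrace>\<^sub>V\<close>)
begin

sublocale V: poisson_algebra scaleE V mulV brV
  by (rule V_poisson)

definition mulE :: "'e \<Rightarrow> 'e \<Rightarrow> 'e" (infixl \<open>\<star>\<close> 75)
  where "mulE = transport V s (crossed_mult mulP (lact, ract, \<theta>, mulV, lie_act, f, brV))"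

definition brE :: "'e \<Rightarrow> 'e \<Rightarrow> 'e" (\<open>\<lbrace>_,_\<rbrace>\<^sub>E\<close>)
  where "brE = transport V s (crossed_bracket brP (lact, ract, \<theta>, mulV, lie_act, f, brV))"

lemma crossed_product_on_eq:
  "crossed_product_on mulP brP V s (lact, ract, \<theta>, mulV, lie_act, f, brV) = (mulE, brE)"
  by (simp add: crossed_product_on_def mulE_def brE_def)

lemma mulE_decomposed:
  "x \<in> V \<Longrightarrow> y \<in> V \<Longrightarrow>
    (s p + x) \<star> (s q + y) = s (p \<odot> q) + (\<theta> p q + p \<rightharpoonup> y + x \<triangleleft> q + x \<cdot> y)"
  by (simp add: mulE_def transport_decomposed glue_def)

lemma brE_decomposed:
  "x \<in> V \<Longrightarrow> y \<in> V \<Longrightarrow>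
    \<lbrace>s p + x,s q + y\<rbrace>\<^sub>E = s \<lbrace>p,q\<rbrace>\<^sub>P + (f p q + p \<triangleright> y - q \<triangleright> x + \<lbrace>x,y\<rbrace>\<^sub>V)"
  by (simp add: brE_def transport_decomposed glue_def)

text \<open>In the next three lemmas both sides are expanded into sums indexed by the choice, for each argument,
  of its part in \<open>P\<close> or in \<open>V\<close>. Of the eight choices, the one with all parts in \<open>V\<close> is the law in the
  Poisson algebra \<open>V\<close>, and each of the others is one axiom; for the Jacobi identity the choices that
  differ by a cyclic shift share an axiom.\<close>

lemma mulE_assoc: "(u \<star> v) \<star> w = u \<star> (v \<star> w)"
proof -
  obtain p x where u: "x \<in> V" "u = s p + x" by (rule decompose)
  obtain q y where v: "y \<in> V" "v = s q + y" by (rule decompose)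
  obtain r z where w: "z \<in> V" "w = s r + z" by (rule decompose)
  show ?thesis
    using u v w
    by (simp add: mulE_decomposed datum_simps V_closed H1 H2 H3 H4 H5 H6 H7 V.mul_assoc P.mul_assoc)
qed

lemma brE_jacobi: "\<lbrace>u,\<lbrace>v,w\<rbrace>\<^sub>E\<rbrace>\<^sub>E + \<lbrace>v,\<lbrace>w,u\<rbrace>\<^sub>E\<rbrace>\<^sub>E + \<lbrace>w,\<lbrace>u,v\<rbrace>\<^sub>E\<rbrace>\<^sub>E = 0"
proof -
  obtain p x where u: "x \<in> V" "u = s p + x" by (rule decompose)
  obtain q y where v: "y \<in> V" "v = s q + y" by (rule decompose)
  obtain r z where w: "z \<in> V" "w = s r + z" by (rule decompose)
  \<comment> \<open>The cyclic sums are solved for their last term, so that the simplifier can eliminate it.\<close>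
  have brP3: "s \<lbrace>r,\<lbrace>p,q\<rbrace>\<^sub>P\<rbrace>\<^sub>P = - s \<lbrace>p,\<lbrace>q,r\<rbrace>\<^sub>P\<rbrace>\<^sub>P - s \<lbrace>q,\<lbrace>r,p\<rbrace>\<^sub>P\<rbrace>\<^sub>P"
  proof -
    have "\<lbrace>r,\<lbrace>p,q\<rbrace>\<^sub>P\<rbrace>\<^sub>P = - \<lbrace>p,\<lbrace>q,r\<rbrace>\<^sub>P\<rbrace>\<^sub>P - \<lbrace>q,\<lbrace>r,p\<rbrace>\<^sub>P\<rbrace>\<^sub>P"
      using P.br_jacobi[of p q r] by (simp add: eq_neg_iff_add_eq_0 algebra_simps)
    then show ?thesis by (simp add: s.neg s.diff)
  qed
  have f3: "f r \<lbrace>p,q\<rbrace>\<^sub>P = - (f p \<lbrace>q,r\<rbrace>\<^sub>P + f q \<lbrace>r,p\<rbrace>\<^sub>P + p \<triangleright> f q r + q \<triangleright> f r p + r \<triangleright> f p q)"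
    using L4[of p q r] by (simp only: eq_neg_iff_add_eq_0) (simp add: algebra_simps)
  have br3: "\<lbrace>z,\<lbrace>x,y\<rbrace>\<^sub>V\<rbrace>\<^sub>V = - \<lbrace>x,\<lbrace>y,z\<rbrace>\<^sub>V\<rbrace>\<^sub>V - \<lbrace>y,\<lbrace>z,x\<rbrace>\<^sub>V\<rbrace>\<^sub>V"
    using V.br_jacobi[of x y z] u v w by (simp add: algebra_simps eq_neg_iff_add_eq_0)
  have anti: "\<lbrace>p \<triangleright> y,z\<rbrace>\<^sub>V = - \<lbrace>z,p \<triangleright> y\<rbrace>\<^sub>V" "\<lbrace>q \<triangleright> z,x\<rbrace>\<^sub>V = - \<lbrace>x,q \<triangleright> z\<rbrace>\<^sub>V" "\<lbrace>r \<triangleright> x,y\<rbrace>\<^sub>V = - \<lbrace>y,r \<triangleright> x\<rbrace>\<^sub>V"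
    using u v w by (auto intro!: V.br_antisym simp: lie_act_simps)
  show ?thesis
    using u v w
    by (simp add: brE_decomposed datum_simps V_closed L2 L3 br3 f3 brP3 anti)
qed

lemma brE_leibniz: "\<lbrace>u \<star> v,w\<rbrace>\<^sub>E = \<lbrace>u,w\<rbrace>\<^sub>E \<star> v + u \<star> \<lbrace>v,w\<rbrace>\<^sub>E"
proof -
  obtain p x where u: "x \<in> V" "u = s p + x" by (rule decompose)
  obtain q y where v: "y \<in> V" "v = s q + y" by (rule decompose)
  obtain r z where w: "z \<in> V" "w = s r + z" by (rule decompose)
  have P1': "f (p \<odot> q) r = f p r \<triangleleft> q + p \<rightharpoonup> f q r
             + (r \<triangleright> \<theta> p q + \<theta> \<lbrace>p,r\<rbrace>\<^sub>P q + \<theta> p \<lbrace>q,r\<rbrace>\<^sub>P)"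
    using P1[of p q r] by (simp add: algebra_simps)
  show ?thesis
    using u v w
    by (simp add: brE_decomposed mulE_decomposed datum_simps V_closed P1' P2 P3 P4 P5 P6 P7 V.leibniz
        P.leibniz s.add)
qed

lemma crossed_product_in_exts: "(mulE, brE) \<in> exts"
proof -
  have "bilinear_on scaleE UNIV scaleE UNIV scaleE UNIV mulE"
    unfolding bilinear_on_def
  proof (intro conjI ballI allI)
    fix u v w c
    obtain p x where u: "x \<in> V" "u = s p + x" by (rule decompose)
    obtain q y where v: "y \<in> V" "v = s q + y" by (rule decompose)
    obtain r z where w: "z \<in> V" "w = s r + z" by (rule decompose)
    note simps = add_decomposed scale_decomposed mulE_decomposed datum_simps V_closed
      P.mul_simps
    show "u \<star> v \<in> UNIV" by simp
    show "(u + v) \<star> w = u \<star> w + v \<star> w" "u \<star> (v + w) = u \<star> v + u \<star> w"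
      "scaleE c u \<star> v = scaleE c (u \<star> v)" "u \<star> scaleE c v = scaleE c (u \<star> v)"
      using u v w by (simp_all add: simps) (simp_all add: E.scale_right_distrib)
  qed
  moreover have "bilinear_on scaleE UNIV scaleE UNIV scaleE UNIV brE"
    unfolding bilinear_on_def
  proof (intro conjI ballI allI)
    fix u v w c
    obtain p x where u: "x \<in> V" "u = s p + x" by (rule decompose)
    obtain q y where v: "y \<in> V" "v = s q + y" by (rule decompose)
    obtain r z where w: "z \<in> V" "w = s r + z" by (rule decompose)
    note simps = add_decomposed scale_decomposed brE_decomposed datum_simps V_closed
      P.br_simps
    show "\<lbrace>u,v\<rbrace>\<^sub>E \<in> UNIV" by simp
    show "\<lbrace>u + v,w\<rbrace>\<^sub>E = \<lbrace>u,w\<rbrace>\<^sub>E + \<lbrace>v,w\<rbrace>\<^sub>E" "\<lbrace>u,v + w\<rbrace>\<^sub>E = \<lbrace>u,v\<rbrace>\<^sub>E + \<lbrace>u,w\<rbrace>\<^sub>E"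
      "\<lbrace>scaleE c u,v\<rbrace>\<^sub>E = scaleE c \<lbrace>u,v\<rbrace>\<^sub>E" "\<lbrace>u,scaleE c v\<rbrace>\<^sub>E = scaleE c \<lbrace>u,v\<rbrace>\<^sub>E"
      using u v w by (simp_all add: simps) (simp_all add: E.scale_right_distrib E.scale_right_diff_distrib)
  qed
  moreover have "\<lbrace>u,u\<rbrace>\<^sub>E = 0" for u
  proof -
    obtain p x where u: "x \<in> V" "u = s p + x" by (rule decompose)
    then show ?thesis by (simp add: brE_decomposed L1 V.br_alternating P.br_alternating)
  qed
  ultimately have "poisson_algebra scaleE UNIV mulE brE"
    by unfold_locales (simp_all add: mulE_assoc brE_jacobi brE_leibniz)
  moreover have "\<pi> (u \<star> v) = \<pi> u \<odot> \<pi> v \<and> \<pi> \<lbrace>u,v\<rbrace>\<^sub>E = \<lbrace>\<pi> u,\<pi> v\<rbrace>\<^sub>P" for u v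
  proof -
    obtain p x where u: "x \<in> V" "u = s p + x" by (rule decompose)
    obtain q y where v: "y \<in> V" "v = s q + y" by (rule decompose)
    show ?thesis
      using u v by (simp add: mulE_decomposed brE_decomposed \<pi>_decompose V_closed datum_simps)
  qed
  ultimately show ?thesis
    using proj.linear_axioms by (simp add: ext_structures_def poisson_hom_def)
qed

end

section \<open>Crossed products up to equivalence\<close>

context split_extension
begin

lemma split_crossed_systemI:
  assumes "(lact, ract, \<theta>, mulV, lie_act, f, brV) \<in> systems"
  shows "split_crossed_system scaleP mulP brP scaleE \<pi> V s lact ract \<theta> mulV lie_act f brV"
  using assms by (simp add: split_crossed_system_def split_extension_axioms crossed_systems_def)

lemma crossed_product_on_in_exts:
  assumes "\<Omega> \<in> systems"
  shows "crossed_product_on mulP brP V s \<Omega> \<in> exts"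
proof -
  obtain lact ract \<theta> mulV lie_act f brV where \<Omega>: "\<Omega> = (lact, ract, \<theta>, mulV, lie_act, f, brV)"
    by (metis prod_cases7)
  interpret X: split_crossed_system scaleP mulP brP scaleE \<pi> V s lact ract \<theta> mulV lie_act f brV
    using assms unfolding \<Omega> by (rule split_crossed_systemI)
  show ?thesis
    unfolding \<Omega> X.crossed_product_on_eq by (rule X.crossed_product_in_exts)
qed

text \<open>This is what makes every extension structure a crossed product. The only point beyond expanding the
  bilinear operations on \<open>s p + x\<close> is that a datum records the bracket of \<open>P\<close> with \<open>V\<close> on one side
  only; the other side is recovered by antisymmetry.\<close>

lemma crossed_product_on_datum_of:
  assumes "(m, b) \<in> exts"
  shows "crossed_product_on mulP brP V s (datum_of m b) = (m, b)"
proof -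
  interpret X: split_crossed_system scaleP mulP brP scaleE \<pi> V s
    "\<lambda>p. \<lambda>x\<in>V. m (s p) x" "\<lambda>x\<in>V. \<lambda>p. m x (s p)" "\<lambda>p q. m (s p) (s q) - s (p \<odot> q)"
    "\<lambda>x\<in>V. \<lambda>y\<in>V. m x y" "\<lambda>p. \<lambda>x\<in>V. b (s p) x" "\<lambda>p q. b (s p) (s q) - s \<lbrace>p,q\<rbrace>\<^sub>P"
    "\<lambda>x\<in>V. \<lambda>y\<in>V. b x y"
    using datum_of_crossed_system[OF assms] unfolding datum_of_def by (rule split_crossed_systemI)
  interpret S: poisson_algebra scaleE UNIV m b
    using assms by (simp add: ext_structures_def)
  note S_simps = S.mul_simps[simplified] S.br_simps[simplified]
  have "X.mulE u v = m u v \<and> X.brE u v = b u v" for u v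
  proof -
    obtain p x where u: "x \<in> V" "u = s p + x" by (rule decompose)
    obtain q y where v: "y \<in> V" "v = s q + y" by (rule decompose)
    show ?thesis
      using u v S.br_antisym[of x "s q"]
      by (simp add: X.mulE_decomposed X.brE_decomposed S_simps)
  qed
  then have "X.mulE = m" "X.brE = b" by (simp_all add: fun_eq_iff)
  then show ?thesis
    unfolding datum_of_def X.crossed_product_on_eq by simp
qed

text \<open>The map \<open>u \<mapsto> u + r (\<pi> u)\<close>, which replaces the lift \<open>s p\<close> by \<open>s p + r p\<close>, is the required morphism:
  the cohomology equations are its compatibility with the operations on pairs from \<open>s P\<close> and \<open>V\<close>.\<close>

lemma cohomologous_imp_equivalent:
  assumes "(lact, ract, \<theta>, mulV, lie_act, f, brV) \<in> systems"
    and "(lact', ract', \<theta>', mulV', lie_act', f', brV') \<in> systems"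
    and "cohomologous scaleP mulP brP scaleE V (lact, ract, \<theta>, mulV, lie_act, f, brV)
      (lact', ract', \<theta>', mulV', lie_act', f', brV')"
  shows "(crossed_product_on mulP brP V s (lact, ract, \<theta>, mulV, lie_act, f, brV),
    crossed_product_on mulP brP V s (lact', ract', \<theta>', mulV', lie_act', f', brV')) \<in> ext_rel"
proof -
  interpret X: split_crossed_system scaleP mulP brP scaleE \<pi> V s lact ract \<theta> mulV lie_act f brV
    using assms(1) by (rule split_crossed_systemI)
  interpret Y: split_crossed_system scaleP mulP brP scaleE \<pi> V s lact' ract' \<theta>' mulV' lie_act' f' brV'
    using assms(2) by (rule split_crossed_systemI)
  note coh = assms(3)[unfolded cohomologous.simps]
  have V_eq: "mulV = mulV'" "brV = brV'" using coh by blast+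
  obtain r where r: "Vector_Spaces.linear scaleP scaleE r" and "range r \<subseteq> V"
    and lact: "\<forall>p. \<forall>x\<in>V. lact p x = lact' p x + mulV' (r p) x"
    and ract: "\<forall>p. \<forall>x\<in>V. ract x p = ract' x p + mulV' x (r p)"
    and \<theta>: "\<forall>p q. \<theta> p q = \<theta>' p q + lact' p (r q) + ract' (r p) q - r (p \<odot> q) + mulV' (r p) (r q)"
    and lie_act: "\<forall>p. \<forall>x\<in>V. lie_act p x = lie_act' p x + brV' (r p) x"
    and f: "\<forall>p q. f p q = f' p q + lie_act' p (r q) - lie_act' q (r p) + brV' (r p) (r q) - r \<lbrace>p,q\<rbrace>\<^sub>P"
    using coh unfolding V_eq by blast
  interpret r: Vector_Spaces.linear scaleP scaleE r by (rule r)
  have r_in: "r p \<in> V" for p using \<open>range r \<subseteq> V\<close> by blast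
  define \<phi> where "\<phi> u = u + r (\<pi> u)" for u
  have \<phi>: "\<phi> (s p + x) = s p + (r p + x)" if "x \<in> V" for p x
    using that by (simp add: \<phi>_def \<pi>_decompose)
  have "\<phi> (X.mulE u v) = Y.mulE (\<phi> u) (\<phi> v) \<and> \<phi> (X.brE u v) = Y.brE (\<phi> u) (\<phi> v)" for u v
  proof -
    obtain p x where u: "x \<in> V" "u = s p + x" by (rule decompose)
    obtain q y where v: "y \<in> V" "v = s q + y" by (rule decompose)
    have mul: "r (p \<odot> q) + (\<theta> p q + lact p y + ract x q + mulV x y) =
        \<theta>' p q + lact' p (r q + y) + ract' (r p + x) q + mulV' (r p + x) (r q + y)"
      using u(1) v(1)
      by (simp only: lact ract \<theta> V_eq) (simp add: Y.datum_simps r_in Y.V_closed)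
    have "brV' x (r q) = - brV' (r q) x"
      using u(1) r_in by (rule Y.V.br_antisym)
    then have br: "r \<lbrace>p,q\<rbrace>\<^sub>P + (f p q + lie_act p y - lie_act q x + brV x y) =
        f' p q + lie_act' p (r q + y) - lie_act' q (r p + x) + brV' (r p + x) (r q + y)"
      using u(1) v(1)
      by (simp only: lie_act f V_eq) (simp add: Y.datum_simps r_in Y.V_closed)
    show ?thesis
      using u v mul br
      by (simp add: X.mulE_decomposed X.brE_decomposed Y.mulE_decomposed Y.brE_decomposed \<phi>
          X.V_closed X.datum_simps r_in)
  qed
  moreover have "Vector_Spaces.linear scaleE scaleE \<phi>"
    by unfold_locales
      (simp_all add: \<phi>_def proj.add proj.scale r.add r.scale E.scale_right_distrib algebra_simps)
  ultimately have "poisson_hom scaleE X.mulE X.brE scaleE Y.mulE Y.brE \<phi>"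
    by (simp add: poisson_hom_def)
  moreover have "\<forall>x. \<pi> x = 0 \<longrightarrow> \<phi> x = x" "\<pi> \<circ> \<phi> = \<pi>"
    using r_in by (auto simp: \<phi>_def fun_eq_iff proj.add in_V_iff r.zero)
  ultimately show ?thesis
    unfolding X.crossed_product_on_eq Y.crossed_product_on_eq
    using X.crossed_product_in_exts Y.crossed_product_in_exts by (auto simp: ext_equiv_rel_def)
qed

text \<open>Conversely \<open>r p = \<phi> (s p) - s p\<close> measures how \<open>\<phi>\<close> moves the section. The equations for the separate
  components come from the compatibility of \<open>\<phi>\<close> with the operations on \<open>s p + x\<close> and \<open>s q + y\<close> by
  setting some of \<open>p\<close>, \<open>q\<close>, \<open>x\<close>, \<open>y\<close> to \<open>0\<close>.\<close>

lemma equivalent_imp_cohomologous: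
  assumes "(lact, ract, \<theta>, mulV, lie_act, f, brV) \<in> systems"
    and "(lact', ract', \<theta>', mulV', lie_act', f', brV') \<in> systems"
    and "(crossed_product_on mulP brP V s (lact, ract, \<theta>, mulV, lie_act, f, brV),
    crossed_product_on mulP brP V s (lact', ract', \<theta>', mulV', lie_act', f', brV')) \<in> ext_rel"
  shows "cohomologous scaleP mulP brP scaleE V (lact, ract, \<theta>, mulV, lie_act, f, brV)
    (lact', ract', \<theta>', mulV', lie_act', f', brV')"
proof -
  interpret X: split_crossed_system scaleP mulP brP scaleE \<pi> V s lact ract \<theta> mulV lie_act f brV
    using assms(1) by (rule split_crossed_systemI)
  interpret Y: split_crossed_system scaleP mulP brP scaleE \<pi> V s lact' ract' \<theta>' mulV' lie_act' f' brV'
    using assms(2) by (rule split_crossed_systemI)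
  obtain \<phi> where \<phi>: "Vector_Spaces.linear scaleE scaleE \<phi>"
    and hom: "\<And>u v. \<phi> (X.mulE u v) = Y.mulE (\<phi> u) (\<phi> v)" "\<And>u v. \<phi> (X.brE u v) = Y.brE (\<phi> u) (\<phi> v)"
    and fix_V: "\<And>x. \<pi> x = 0 \<Longrightarrow> \<phi> x = x" and "\<pi> \<circ> \<phi> = \<pi>"
    using assms(3) unfolding X.crossed_product_on_eq Y.crossed_product_on_eq
    by (auto simp: ext_equiv_rel_def poisson_hom_def)
  then have over_P: "\<pi> (\<phi> u) = \<pi> u" for u
    by (simp add: fun_eq_iff)
  interpret \<phi>: Vector_Spaces.linear scaleE scaleE \<phi> by (rule \<phi>)
  define r where "r p = \<phi> (s p) - s p" for p
  have r: "Vector_Spaces.linear scaleP scaleE r"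
    by unfold_locales
      (simp_all add: r_def \<phi>.add \<phi>.scale s.add s.scale E.scale_right_diff_distrib algebra_simps)
  interpret r: Vector_Spaces.linear scaleP scaleE r by (rule r)
  have r_in: "r p \<in> V" for p
    by (simp add: r_def in_V_iff proj.diff over_P)
  have \<phi>_eq: "\<phi> (s p + x) = s p + (r p + x)" if "x \<in> V" for p x
    using that fix_V[of x] by (simp add: r_def \<phi>.add in_V_iff)
  have mul: "r (p \<odot> q) + (\<theta> p q + lact p y + ract x q + mulV x y) =
      \<theta>' p q + lact' p (r q + y) + ract' (r p + x) q + mulV' (r p + x) (r q + y)"
    if "x \<in> V" "y \<in> V" for p q x y
    using hom(1)[of "s p + x" "s q + y"] that
    by (simp add: X.mulE_decomposed Y.mulE_decomposed \<phi>_eq X.V_closed X.datum_simps r_in)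
  have br: "r \<lbrace>p,q\<rbrace>\<^sub>P + (f p q + lie_act p y - lie_act q x + brV x y) =
      f' p q + lie_act' p (r q + y) - lie_act' q (r p + x) + brV' (r p + x) (r q + y)"
    if "x \<in> V" "y \<in> V" for p q x y
    using hom(2)[of "s p + x" "s q + y"] that
    by (simp add: X.brE_decomposed Y.brE_decomposed \<phi>_eq X.V_closed X.datum_simps r_in)
  note zeros = X.V_closed X.datum_simps Y.datum_simps r.zero P.mul_simps P.br_simps r_in
  \<comment> \<open>The operations of the two systems agree on \<open>V\<close>, and they are equal as functions because both
    are extensional.\<close>
  have V_eq: "mulV x y = mulV' x y \<and> brV x y = brV' x y" if "x \<in> V" "y \<in> V" for x y
    using mul[of x y 0 0] br[of x y 0 0] that by (simp add: zeros)
  then have "mulV = mulV'"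
    by (intro PiE_ext[OF X.mulV_map Y.mulV_map]
        PiE_ext[OF PiE_mem[OF X.mulV_map] PiE_mem[OF Y.mulV_map]]) auto
  moreover have "brV = brV'"
    using V_eq by (intro PiE_ext[OF X.brV_map Y.brV_map]
        PiE_ext[OF PiE_mem[OF X.brV_map] PiE_mem[OF Y.brV_map]]) auto
  moreover have "lact p x = lact' p x + mulV' (r p) x" "ract x p = ract' x p + mulV' x (r p)"
    "lie_act p x = lie_act' p x + brV' (r p) x" if "x \<in> V" for p x
    using mul[of 0 x p 0] mul[of x 0 0 p] br[of 0 x p 0] that by (simp_all add: zeros)
  moreover have "\<theta> p q = \<theta>' p q + lact' p (r q) + ract' (r p) q - r (p \<odot> q) + mulV' (r p) (r q)"
    "f p q = f' p q + lie_act' p (r q) - lie_act' q (r p) + brV' (r p) (r q) - r \<lbrace>p,q\<rbrace>\<^sub>P" for p q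
    using mul[of 0 0 p q] br[of 0 0 p q] by (simp_all add: zeros algebra_simps)
  moreover have "range r \<subseteq> V" using r_in by blast
  ultimately show ?thesis
    unfolding cohomologous.simps using r by blast
qed

lemma cohomologous_iff_equivalent:
  assumes "\<Omega> \<in> systems" "\<Omega>' \<in> systems"
  shows "(\<Omega>, \<Omega>') \<in> coh_rel \<longleftrightarrow>
    (crossed_product_on mulP brP V s \<Omega>, crossed_product_on mulP brP V s \<Omega>') \<in> ext_rel"
proof -
  obtain lact ract \<theta> mulV lie_act f brV where \<Omega>: "\<Omega> = (lact, ract, \<theta>, mulV, lie_act, f, brV)"
    by (metis prod_cases7)
  obtain lact' ract' \<theta>' mulV' lie_act' f' brV'
    where \<Omega>': "\<Omega>' = (lact', ract', \<theta>', mulV', lie_act', f', brV')"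
    by (metis prod_cases7)
  have "(\<Omega>, \<Omega>') \<in> coh_rel \<longleftrightarrow> cohomologous scaleP mulP brP scaleE V \<Omega> \<Omega>'"
    using assms by (simp add: cohomology_rel_def del: cohomologous.simps)
  also have "\<dots> \<longleftrightarrow>
    (crossed_product_on mulP brP V s \<Omega>, crossed_product_on mulP brP V s \<Omega>') \<in> ext_rel"
    using cohomologous_imp_equivalent[OF assms[unfolded \<Omega> \<Omega>']]
      equivalent_imp_cohomologous[OF assms[unfolded \<Omega> \<Omega>']]
    unfolding \<Omega> \<Omega>' by (rule iffI)
  finally show ?thesis .
qed

text \<open>Both structures are transported from the same operations on \<open>P \<times> V\<close>, so the map
  \<open>s p + x \<mapsto> s' p + x\<close> between the two identifications of \<open>P \<times> V\<close> with \<open>E\<close> is a morphism.\<close>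

lemma crossed_product_on_section_independent:
  assumes "\<Omega> \<in> systems" "linear_section scaleP scaleE \<pi> s'"
  shows "(crossed_product_on mulP brP V s \<Omega>, crossed_product_on mulP brP V s' \<Omega>) \<in> ext_rel"
proof -
  interpret s': split_extension scaleP mulP brP scaleE \<pi> V s'
    by unfold_locales (rule assms(2))
  obtain lact ract \<theta> mulV lie_act f brV where \<Omega>: "\<Omega> = (lact, ract, \<theta>, mulV, lie_act, f, brV)"
    by (metis prod_cases7)
  interpret X: split_crossed_system scaleP mulP brP scaleE \<pi> V s lact ract \<theta> mulV lie_act f brV
    using assms(1) unfolding \<Omega> by (rule split_crossed_systemI)
  interpret Y: split_crossed_system scaleP mulP brP scaleE \<pi> V s' lact ract \<theta> mulV lie_act f brV
    using assms(1) unfolding \<Omega> by (rule s'.split_crossed_systemI)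
  define \<phi> where "\<phi> u = s' (\<pi> u) + (u - s (\<pi> u))" for u
  have \<phi>: "\<phi> (s p + x) = s' p + x" if "x \<in> V" for p x
    using that by (simp add: \<phi>_def \<pi>_decompose)
  have "\<phi> (X.mulE u v) = Y.mulE (\<phi> u) (\<phi> v) \<and> \<phi> (X.brE u v) = Y.brE (\<phi> u) (\<phi> v)" for u v
  proof -
    obtain p x where u: "x \<in> V" "u = s p + x" by (rule decompose)
    obtain q y where v: "y \<in> V" "v = s q + y" by (rule decompose)
    show ?thesis
      using u v by (simp add: X.mulE_decomposed X.brE_decomposed Y.mulE_decomposed Y.brE_decomposed \<phi>
          X.V_closed X.datum_simps)
  qed
  moreover have "Vector_Spaces.linear scaleE scaleE \<phi>"
    by unfold_locales
      (simp_all add: \<phi>_def proj.add proj.scale s.add s.scale s'.s.add s'.s.scale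
        E.scale_right_distrib E.scale_right_diff_distrib algebra_simps)
  ultimately have "poisson_hom scaleE X.mulE X.brE scaleE Y.mulE Y.brE \<phi>"
    by (simp add: poisson_hom_def)
  moreover have "\<forall>x. \<pi> x = 0 \<longrightarrow> \<phi> x = x" "\<pi> \<circ> \<phi> = \<pi>"
    by (auto simp: \<phi>_def fun_eq_iff proj.add proj.diff \<pi>_s s'.\<pi>_s s.zero s'.s.zero)
  ultimately show ?thesis
    using X.crossed_product_in_exts Y.crossed_product_in_exts
    unfolding \<Omega> X.crossed_product_on_eq Y.crossed_product_on_eq by (auto simp: ext_equiv_rel_def)
qed

end

section \<open>The bijection of quotients\<close>

text \<open>The image of a class is taken as \<open>S `` (g ` X)\<close>, which needs no choice of a representative.
  Injectivity is the pullback property of \<open>R\<close>; surjectivity only has to hold up to \<open>S\<close>.\<close>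

lemma equiv_pullback_quotient_bij:
  assumes S: "equiv B S"
    and g: "\<And>a. a \<in> A \<Longrightarrow> g a \<in> B" "\<And>y. y \<in> B \<Longrightarrow> \<exists>a\<in>A. (g a, y) \<in> S"
    and R: "R \<subseteq> A \<times> A" "\<And>a a'. a \<in> A \<Longrightarrow> a' \<in> A \<Longrightarrow> (a, a') \<in> R \<longleftrightarrow> (g a, g a') \<in> S"
  shows "equiv A R"
    and "\<exists>F. bij_betw F (A // R) (B // S) \<and> (\<forall>a\<in>A. F (R `` {a}) = S `` {g a})"
proof -
  show equiv_R: "equiv A R"
  proof (rule equivI)
    show "refl_on A R"
      using S R g(1) by (auto simp: refl_on_def equiv_def)
    show "sym R"
    proof (rule symI)
      fix a b assume ab: "(a, b) \<in> R"
      then have "a \<in> A" "b \<in> A" using R(1) by auto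
      with ab show "(b, a) \<in> R" using S by (auto simp: R(2) elim: equivE dest: symD)
    qed
    show "trans R"
    proof (rule transI)
      fix a b c assume abc: "(a, b) \<in> R" "(b, c) \<in> R"
      then have "a \<in> A" "b \<in> A" "c \<in> A" using R(1) by auto
      with abc show "(a, c) \<in> R" using S by (auto simp: R(2) elim: equivE dest: transD)
    qed
  qed (rule R(1))
  define F where "F X = S `` (g ` X)" for X
  have F: "F (R `` {a}) = S `` {g a}" if a: "a \<in> A" for a
  proof
    show "S `` {g a} \<subseteq> F (R `` {a})"
      using equiv_class_self[OF equiv_R a] by (auto simp: F_def)
    show "F (R `` {a}) \<subseteq> S `` {g a}"
    proof
      fix y assume "y \<in> F (R `` {a})"
      then obtain a' where a': "(a, a') \<in> R" "(g a', y) \<in> S" by (auto simp: F_def)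
      then have "a' \<in> A" using R(1) by blast
      with a a'(1) have "(g a, g a') \<in> S" by (simp add: R(2))
      then show "y \<in> S `` {g a}" using S a'(2) by (meson ImageI equivE singletonI transD)
    qed
  qed
  have "bij_betw F (A // R) (B // S)"
    unfolding bij_betw_def
  proof
    show "inj_on F (A // R)"
    proof (rule inj_onI)
      fix X Y assume XY: "X \<in> A // R" "Y \<in> A // R" "F X = F Y"
      obtain a where a: "a \<in> A" "X = R `` {a}" using XY(1) by (rule quotientE)
      obtain a' where a': "a' \<in> A" "Y = R `` {a'}" using XY(2) by (rule quotientE)
      have "S `` {g a} = S `` {g a'}" using XY(3) a a' by (simp add: F)
      then have "(g a, g a') \<in> S" using eq_equiv_class[OF _ S g(1)[OF a'(1)]] by simp
      then have "(a, a') \<in> R" using R(2) a(1) a'(1) by simp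
      then show "X = Y" unfolding a(2) a'(2) by (rule equiv_class_eq[OF equiv_R])
    qed
    show "F ` (A // R) = B // S"
    proof (intro equalityI subsetI)
      fix Y assume "Y \<in> F ` (A // R)"
      then obtain X where X: "X \<in> A // R" "Y = F X" by blast
      obtain a where a: "a \<in> A" "X = R `` {a}" using X(1) by (rule quotientE)
      show "Y \<in> B // S" unfolding X(2) a(2) F[OF a(1)] by (rule quotientI[OF g(1)[OF a(1)]])
    next
      fix Y assume "Y \<in> B // S"
      then obtain y where y: "y \<in> B" "Y = S `` {y}" by (rule quotientE)
      obtain a where a: "a \<in> A" "(g a, y) \<in> S" using g(2) y(1) by blast
      have "Y = F (R `` {a})"
        unfolding y(2) F[OF a(1)] equiv_class_eq[OF S a(2)] ..
      with a(1) show "Y \<in> F ` (A // R)" by (simp add: quotientI)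
    qed
  qed
  with F show "\<exists>F. bij_betw F (A // R) (B // S) \<and> (\<forall>a\<in>A. F (R `` {a}) = S `` {g a})"
    by blast
qed

theorem theorem2p9:
  fixes scaleP :: "'k::field \<Rightarrow> 'p::ab_group_add \<Rightarrow> 'p"
    and mulP brP :: "'p \<Rightarrow> 'p \<Rightarrow> 'p"
    and scaleE :: "'k \<Rightarrow> 'e::ab_group_add \<Rightarrow> 'e"
    and \<pi> :: "'e \<Rightarrow> 'p"
    and V :: "'e set"
  assumes "poisson_algebra scaleP UNIV mulP brP"
    and "vector_space scaleE"
    and "Vector_Spaces.linear scaleE scaleP \<pi>"
    and "surj \<pi>"
    and "V = {x. \<pi> x = 0}"
  shows "equiv (crossed_systems scaleP mulP brP scaleE V) (cohomology_rel scaleP mulP brP scaleE V) \<and>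
    (\<exists>F. bij_betw F (GPH2 scaleP mulP brP scaleE V) (Gext scaleP mulP brP scaleE \<pi>) \<and>
      (\<forall>s. linear_section scaleP scaleE \<pi> s \<longrightarrow>
        (\<forall>\<Omega> \<in> crossed_systems scaleP mulP brP scaleE V.
          F (cohomology_rel scaleP mulP brP scaleE V `` {\<Omega>}) =
          ext_equiv_rel scaleP mulP brP scaleE \<pi> `` {crossed_product_on mulP brP V s \<Omega>})))"
proof -
  obtain s where s: "linear_section scaleP scaleE \<pi> s"
    using linear_section_exists assms(3,4) by blast
  interpret vector_space_extension scaleP mulP brP scaleE \<pi> V
    using assms by (simp add: vector_space_extension_def vector_space_extension_axioms_def)
  interpret split_extension scaleP mulP brP scaleE \<pi> V s
    by unfold_locales (rule s)
  let ?cp = "crossed_product_on mulP brP V s"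
  have surj: "\<exists>\<Omega>\<in>systems. (?cp \<Omega>, S) \<in> ext_rel" if "S \<in> exts" for S
  proof (cases S)
    case (Pair m b)
    with that show ?thesis
      using datum_of_crossed_system crossed_product_on_datum_of equiv_ext_rel
      by (metis equivE refl_onD)
  qed
  have coh: "coh_rel \<subseteq> systems \<times> systems"
    by (auto simp: cohomology_rel_def)
  note pullback = equiv_pullback_quotient_bij[of exts ext_rel systems ?cp coh_rel,
      OF equiv_ext_rel crossed_product_on_in_exts surj coh cohomologous_iff_equivalent]
  obtain F where bij: "bij_betw F (systems // coh_rel) (exts // ext_rel)"
    and F: "\<And>\<Omega>. \<Omega> \<in> systems \<Longrightarrow> F (coh_rel `` {\<Omega>}) = ext_rel `` {?cp \<Omega>}"
    using pullback(2) by blast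
  have "F (coh_rel `` {\<Omega>}) = ext_rel `` {crossed_product_on mulP brP V s' \<Omega>}"
    if "linear_section scaleP scaleE \<pi> s'" "\<Omega> \<in> systems" for s' \<Omega>
    using F that equiv_class_eq[OF equiv_ext_rel crossed_product_on_section_independent] by simp
  with pullback(1) bij show ?thesis
    unfolding GPH2_def Gext_def by blast
qed

end
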